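(* Let $\alpha = \sqrt[40]{\theta(40)}$, where $\theta(40) = 22388184630824$. Then for every integer $p \geq 2$ and every integer $n$ with $5\cdot 2^{p+1} \leq n \leq 5\cdot 2^{p+2}-1$, \[ \theta(n) \geq 2^{2^{p-2}-1}\alpha^{n}. \]
   Context: For a positive integer $n$, let $[n]=\{1,2,\ldots,n\}$. A permutation $(a_1,a_2,\ldots,a_n)$ of $[n]$ is called 3-free if there do not exist indices $i<j<k$ with $a_i + a_k = 2a_j$, i.e., it contains no 3-term arithmetic progression as a subsequence. $\theta(n)$ denotes the number of 3-free permutations of $[n]$. *)

theory Defs
  imports Complex_Main "HOL-Combinatorics.Multiset_Permutations"
begin

text \<open>
  A permutation \<open>(a\<^sub>1, \<dots>, a\<^sub>n)\<close> of \<open>{1, \<dots>, n}\<close> is represented by the list of its entries,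
  so the entry \<open>a\<^sub>i\<close> is the list element at index \<open>i - 1\<close>.
\<close>

definition three_free :: "nat list \<Rightarrow> bool" where
  "three_free a \<longleftrightarrow>
     \<not> (\<exists>i j k. i < j \<and> j < k \<and> k < length a \<and> a ! i + a ! k = 2 * a ! j)"

definition theta :: "nat \<Rightarrow> nat" where
  "theta n = card {a \<in> permutations_of_set {1..n}. three_free a}"

end

theory Submission
  imports Defs
begin

text \<open>
  Building a permutation from left to right and recording only the set \<open>s\<close> of entries placed so
  far, the entry \<open>x\<close> may come next iff \<open>s\<close> is symmetric about \<open>x\<close> as far as both sides stay inside
  \<open>{1..n}\<close>. So \<open>theta n\<close> counts the paths from the empty to the full set, and dynamic
  programming over the levels of the subset lattice computes it. Only very few states lie on a path
  that reaches the full set (3574 for \<open>n = 40\<close>); since the trace of such a state on any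
  subprogression is again such a state, the table for length \<open>n\<close> prunes the computation for
  \<open>2 * n\<close>. Arbitrary pruning still gives lower bounds.

  Putting all odd before all even entries, or conversely, gives
  \<open>theta n \<ge> 2 * theta (n div 2) * theta ((n + 1) div 2)\<close>. With a few computed values this yields
  the bound for \<open>40 \<le> n \<le> 80\<close>, and then for all larger \<open>n\<close> by induction on \<open>p\<close>.
\<close>

section \<open>Building a 3-free permutation one entry at a time\<close>

text \<open>In a state \<open>s\<close>, the bit \<open>s ! x\<close> tells whether the entry \<open>x + 1\<close> has been placed.\<close>
definition allowed :: "bool list \<Rightarrow> nat \<Rightarrow> bool" where
  "allowed s x \<longleftrightarrow> x < length s \<and> \<not> s ! x \<and>
     (\<forall>d\<le>x. x + d < length s \<longrightarrow> s ! (x - d) = s ! (x + d))"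

fun path :: "bool list \<Rightarrow> nat list \<Rightarrow> bool list \<Rightarrow> bool" where
  "path s [] t \<longleftrightarrow> s = t"
| "path s (x # u) t \<longleftrightarrow> allowed s x \<and> path (s[x := True]) u t"

abbreviation none :: "nat \<Rightarrow> bool list" where "none n \<equiv> replicate n False"
abbreviation all :: "nat \<Rightarrow> bool list" where "all n \<equiv> replicate n True"

lemma path_length: "path s u t \<Longrightarrow> length t = length s"
  by (induction u arbitrary: s) fastforce+

lemma path_append: "path s (u @ v) t \<longleftrightarrow> (\<exists>r. path s u r \<and> path r v t)"
  by (induction u arbitrary: s) auto

section \<open>Paths and 3-free permutations\<close>

text \<open>The symmetry condition of \<open>allowed\<close> for a predicate in place of a bit list,
  so that a prefix of the permutation can describe the state.\<close>

definition balanced :: "nat \<Rightarrow> (nat \<Rightarrow> bool) \<Rightarrow> nat \<Rightarrow> bool" where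
  "balanced n P x \<longleftrightarrow> (\<forall>d\<le>x. x + d < n \<longrightarrow> P (x - d) = P (x + d))"

lemma balanced_cong:
  "x < n \<Longrightarrow> (\<And>y. y < n \<Longrightarrow> P y = Q y) \<Longrightarrow> balanced n P x = balanced n Q x"
  by (simp add: balanced_def)

text \<open>Unrolls \<open>path\<close>: after the prefix \<open>v\<close> the set bits are those of
  \<open>s\<close> and those in \<open>v\<close>, so every step becomes a condition on a prefix of
  \<open>u\<close>. The start \<open>s\<close> is arbitrary for the sake of the induction.\<close>

lemma path_all_iff:
  "path s u (all (length s)) \<longleftrightarrow>
     distinct u \<and> set u = {x. x < length s \<and> \<not> s ! x} \<and>
     (\<forall>v x w. u = v @ x # w \<longrightarrow> balanced (length s) (\<lambda>y. s ! y \<or> y \<in> set v) x)"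
proof (induction u arbitrary: s)
  case Nil
  have "s = all (length s) \<longleftrightarrow> {x. x < length s \<and> \<not> s ! x} = {}"
    by (auto simp: list_eq_iff_nth_eq)
  then show ?case by (simp add: eq_commute)
next
  case (Cons y u)
  let ?s = "s[y := True]" and ?n = "length s"
  have split: "(\<forall>v x w. y # u = v @ x # w \<longrightarrow> Q v x) \<longleftrightarrow>
      Q [] y \<and> (\<forall>v x w. u = v @ x # w \<longrightarrow> Q (y # v) x)" for Q
    by (auto simp: Cons_eq_append_conv)
  have IH: "path ?s u (all ?n) \<longleftrightarrow> distinct u \<and> set u = {x. x < ?n \<and> \<not> ?s ! x} \<and>
     (\<forall>v x w. u = v @ x # w \<longrightarrow> balanced ?n (\<lambda>z. ?s ! z \<or> z \<in> set v) x)"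
    using Cons.IH[of ?s] by simp
  show ?case
  proof (cases "y < ?n \<and> \<not> s ! y")
    case True
    have eq: "balanced ?n (\<lambda>z. ?s ! z \<or> z \<in> set v) x =
        balanced ?n (\<lambda>z. s ! z \<or> z \<in> set (y # v)) x" if "x < ?n" for v x
      using that True by (intro balanced_cong) (auto simp: nth_list_update)
    have "(distinct u \<and> set u = {x. x < ?n \<and> \<not> ?s ! x}) \<longleftrightarrow>
        (distinct (y # u) \<and> set (y # u) = {x. x < ?n \<and> \<not> s ! x})"
    proof -
      have "{x. x < ?n \<and> \<not> ?s ! x} = {x. x < ?n \<and> \<not> s ! x} - {y}"
        using True by (auto simp: nth_list_update)
      then show ?thesis
        using True by auto
    qed
    moreover have "(\<forall>v x w. u = v @ x # w \<longrightarrow> balanced ?n (\<lambda>z. ?s ! z \<or> z \<in> set v) x) \<longleftrightarrow>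
        (\<forall>v x w. u = v @ x # w \<longrightarrow> balanced ?n (\<lambda>z. s ! z \<or> z \<in> set (y # v)) x)"
      if "set u \<subseteq> {..< ?n}"
    proof -
      have "x < ?n" if "u = v @ x # w" for v x w
        using that \<open>set u \<subseteq> {..< ?n}\<close> by auto
      then show ?thesis
        using eq by blast
    qed
    moreover have "allowed s y \<longleftrightarrow> balanced ?n (\<lambda>z. s ! z \<or> z \<in> set []) y"
      using True by (auto simp: allowed_def balanced_def)
    ultimately show ?thesis
      unfolding path.simps IH split by blast
  next
    case False
    then have "\<not> allowed s y" "set (y # u) \<noteq> {x. x < ?n \<and> \<not> s ! x}"
      using list.set_intros(1)[of y u] by (simp add: allowed_def, metis (lifting) mem_Collect_eq)
    then show ?thesis by simp
  qed
qed

lemma three_free_map_Suc: "three_free (map Suc u) \<longleftrightarrow> three_free u"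
  unfolding three_free_def by fastforce

text \<open>The terms x - d, x, x + d occur in this or the opposite order exactly when, at the
  moment x is placed, one outer term is already there and the other is not.\<close>

lemma three_free_iff_balanced:
  assumes u: "distinct u" "set u = {..<n}"
  shows "three_free u \<longleftrightarrow> (\<forall>v x w. u = v @ x # w \<longrightarrow> balanced n (\<lambda>y. y \<in> set v) x)"
proof
  assume free: "three_free u"
  show "\<forall>v x w. u = v @ x # w \<longrightarrow> balanced n (\<lambda>y. y \<in> set v) x"
  proof (intro allI impI)
    fix v x w assume split: "u = v @ x # w"
    \<comment> \<open>Such a \<open>z\<close> must still come after \<open>x\<close>, so
      \<open>y\<close>, \<open>x\<close>, \<open>z\<close> would be a progression in this
      order.\<close>
    have False if yz: "y \<in> set v" "z \<notin> set v" "z < n" "y + z = 2 * x" for y z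
    proof -
      have "z \<in> set w"
      proof -
        have "z \<in> set u" "z \<noteq> x"
          using u yz split by auto
        then show ?thesis
          using yz split by auto
      qed
      then obtain k where k: "k < length w" "w ! k = z"
        by (auto simp: in_set_conv_nth)
      obtain i where i: "i < length v" "v ! i = y"
        using yz by (auto simp: in_set_conv_nth)
      have "u ! i + u ! (length v + 1 + k) = 2 * u ! length v"
        using split i k yz by (simp add: nth_append)
      moreover have "length v + 1 + k < length u"
        using split k by simp
      ultimately show False
        using free i(1) unfolding three_free_def by (metis less_add_one trans_less_add1)
    qed
    note * = this
    show "balanced n (\<lambda>y. y \<in> set v) x"
      unfolding balanced_def
    proof (intro allI impI)
      fix d assume d: "d \<le> x" "x + d < n"
      have "x - d + (x + d) = 2 * x" "x + d + (x - d) = 2 * x" "x - d < n"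
        using d by auto
      then show "(x - d \<in> set v) = (x + d \<in> set v)"
        using *[of "x - d" "x + d"] *[of "x + d" "x - d"] d(2) by blast
    qed
  qed
next
  assume bal: "\<forall>v x w. u = v @ x # w \<longrightarrow> balanced n (\<lambda>y. y \<in> set v) x"
  show "three_free u"
    unfolding three_free_def
  proof clarify
    fix i j k assume ijk: "i < j" "j < k" "k < length u" and ap: "u ! i + u ! k = 2 * u ! j"
    let ?v = "take j u"
    have "u = ?v @ u ! j # drop (Suc j) u"
      using ijk by (simp add: id_take_nth_drop)
    then have b: "balanced n (\<lambda>y. y \<in> set ?v) (u ! j)"
      using bal by blast
    have i: "u ! i \<in> set ?v"
      using ijk by (force simp: in_set_conv_nth)
    have k: "u ! k \<notin> set ?v"
      using ijk u(1) by (auto simp: in_set_conv_nth nth_eq_iff_index_eq)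
    have lt: "u ! i < n" "u ! k < n"
      using u(2) ijk by (metis lessThan_iff less_trans nth_mem)+
    show False
    \<comment> \<open>\<open>balanced\<close> is applied at the distance between
      \<open>u ! i\<close> and \<open>u ! j\<close>, written as the difference that is not
      truncated.\<close>
    proof (cases "u ! i \<le> u ! j")
      case True
      then have "u ! j - (u ! j - u ! i) = u ! i" "u ! j + (u ! j - u ! i) = u ! k"
        using ap by auto
      then show False
        using b i k lt unfolding balanced_def by (metis diff_le_self)
    next
      case False
      then have "u ! j - (u ! i - u ! j) = u ! k" "u ! j + (u ! i - u ! j) = u ! i" "u ! i - u ! j \<le> u ! j"
        using ap by auto
      then show False
        using b i k lt unfolding balanced_def by metis
    qed
  qed
qed

text \<open>Positions count from 0 and entries from 1; the shift \<open>map Suc\<close> preserves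
  3-freeness and gives the bijection.\<close>

lemma theta_eq_card_paths: "theta n = card {u. path (none n) u (all n)}"
proof -
  have iff: "path (none n) u (all n) \<longleftrightarrow> distinct u \<and> set u = {..<n} \<and> three_free u" for u
  proof -
    have "balanced n (\<lambda>y. none n ! y \<or> y \<in> set v) x = balanced n (\<lambda>y. y \<in> set v) x" if "x < n" for v x
      using that by (intro balanced_cong) auto
    moreover have "{x. x < n \<and> \<not> none n ! x} = {..<n}"
      by auto
    moreover have "x < n" if "set u = {..<n}" "u = v @ x # w" for v x w
      using that by (auto simp: set_eq_iff)
    ultimately have "path (none n) u (all n) \<longleftrightarrow> distinct u \<and> set u = {..<n} \<and>
        (\<forall>v x w. u = v @ x # w \<longrightarrow> balanced n (\<lambda>y. y \<in> set v) x)"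
      using path_all_iff[of "none n" u] unfolding length_replicate by (smt (verit))
    then show ?thesis
      using three_free_iff_balanced[of u n] by blast
  qed
  have "map Suc ` {u. path (none n) u (all n)} = {a \<in> permutations_of_set {1..n}. three_free a}"
  proof (intro equalityI subsetI)
    fix a assume "a \<in> map Suc ` {u. path (none n) u (all n)}"
    then obtain u where u: "a = map Suc u" "distinct u" "set u = {..<n}" "three_free u"
      using iff by blast
    then have "set a = {1..n}" "distinct a" "three_free a"
      by (simp_all add: image_Suc_lessThan three_free_map_Suc distinct_map)
    then show "a \<in> {a \<in> permutations_of_set {1..n}. three_free a}"
      by (simp add: permutations_of_set_def)
  next
    fix a assume a: "a \<in> {a \<in> permutations_of_set {1..n}. three_free a}"
    let ?u = "map (\<lambda>x. x - 1) a"
    have s: "set a = {1..n}" "distinct a" "three_free a"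
      using a by (auto simp: permutations_of_set_def)
    have m: "map Suc ?u = a"
      unfolding map_map using s(1) by (intro map_idI) auto
    have "distinct ?u"
      using s(2) m by (metis distinct_map)
    moreover have "set ?u = {..<n}"
      using s(1) m by (metis image_Suc_lessThan inj_Suc inj_image_eq_iff list.set_map)
    moreover have "three_free ?u"
      using s(3) m by (metis three_free_map_Suc)
    ultimately show "a \<in> map Suc ` {u. path (none n) u (all n)}"
      using m iff by (intro image_eqI[of _ _ ?u]) auto
  qed
  moreover have "inj_on (map Suc) {u. path (none n) u (all n)}"
    by (simp add: inj_on_def)
  ultimately show ?thesis
    unfolding theta_def by (metis card_image)
qed

section \<open>Successors of a state\<close>

text \<open>The comparison stops with the shorter list: a mirror pair with one side out of range
  imposes no condition.\<close>

fun mirrored :: "bool list \<Rightarrow> bool list \<Rightarrow> bool" where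
  "mirrored [] r \<longleftrightarrow> True"
| "mirrored (b # p) [] \<longleftrightarrow> True"
| "mirrored (b # p) (c # r) \<longleftrightarrow> b = c \<and> mirrored p r"

text \<open>
  The states reachable in one step from \<open>rev p @ r\<close> by an entry inside \<open>r\<close>, with the unchanged
  part \<open>rev p\<close> stripped off.
\<close>
fun succs :: "bool list \<Rightarrow> bool list \<Rightarrow> bool list set" where
  "succs p [] = {}"
| "succs p (True # r) = (#) True ` succs (True # p) r"
| "succs p (False # r) =
     (if mirrored p r then {True # r} else {}) \<union> (#) False ` succs (False # p) r"

lemma mirrored_iff: "mirrored p r \<longleftrightarrow> (\<forall>d < length p. d < length r \<longrightarrow> p ! d = r ! d)"
proof (induction p r rule: mirrored.induct)
  case (3 b p c r)
  then show ?case
    by (simp add: All_less_Suc2 imp_conjL)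
qed auto

text \<open>The first argument of \<open>succs\<close> holds the bits to the left, nearest first; at
  index \<open>i\<close> it has grown by the reversed first \<open>i\<close> bits of
  \<open>r\<close>.\<close>

lemma succs_eq: "succs p r = (\<lambda>i. r[i := True]) `
    {i. i < length r \<and> \<not> r ! i \<and> mirrored (rev (take i r) @ p) (drop (Suc i) r)}"
proof (induction r arbitrary: p)
  case (Cons b r)
  let ?I = "\<lambda>p r. {i. i < length r \<and> \<not> r ! i \<and> mirrored (rev (take i r) @ p) (drop (Suc i) r)}"
  have split: "?I p (b # r) = (if \<not> b \<and> mirrored p r then {0} else {}) \<union> Suc ` ?I (b # p) r"
    (is "?L = ?R")
  proof (rule set_eqI)
    fix i show "i \<in> ?L \<longleftrightarrow> i \<in> ?R"
      by (cases i) auto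
  qed
  have "(\<lambda>i. (b # r)[i := True]) ` Suc ` ?I (b # p) r = (#) b ` succs (b # p) r"
    unfolding Cons.IH by (simp add: image_image)
  then show ?case
    unfolding split image_Un by (cases b) auto
qed simp

lemma succs_Nil: "succs [] s = (\<lambda>x. s[x := True]) ` {x. allowed s x}"
proof -
  have "mirrored (rev (take x s)) (drop (Suc x) s) \<longleftrightarrow>
      (\<forall>d\<le>x. x + d < length s \<longrightarrow> s ! (x - d) = s ! (x + d))" (is "_ \<longleftrightarrow> ?R")
    if "x < length s" for x
  proof -
    have "?R \<longleftrightarrow> (\<forall>d < Suc x. x + d < length s \<longrightarrow> s ! (x - d) = s ! (x + d))"
      by (simp add: less_Suc_eq_le)
    \<comment> \<open>Distance 0 compares the bit with itself; the other distances are shifted by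
      one to become list indices.\<close>
    also have "\<dots> \<longleftrightarrow> (\<forall>d < x. x + Suc d < length s \<longrightarrow> s ! (x - Suc d) = s ! (x + Suc d))"
      by (simp add: All_less_Suc2)
    also have "\<dots> \<longleftrightarrow> mirrored (rev (take x s)) (drop (Suc x) s)"
      using that by (auto simp: mirrored_iff rev_nth less_diff_conv add.commute)
    finally show ?thesis by blast
  qed
  then show ?thesis
    unfolding succs_eq allowed_def by (intro image_cong) auto
qed

lemma finite_succs: "finite (succs p r)"
  by (induction p r rule: succs.induct) auto

section \<open>Counting the completions of a state\<close>

fun completions :: "nat \<Rightarrow> bool list \<Rightarrow> nat" where
  "completions 0 s = (if s = all (length s) then 1 else 0)"
| "completions (Suc k) s = (\<Sum>t\<in>succs [] s. completions k t)"

lemma path_set: "path s u t \<Longrightarrow> set u \<subseteq> {..<length s}"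
  by (induction u arbitrary: s) (fastforce simp: allowed_def)+

lemma completions_eq_card:
  "completions k s = card {u. length u = k \<and> path s u (all (length s))}"
proof (induction k arbitrary: s)
  case 0
  have "{u. length u = 0 \<and> path s u (all (length s))} = (if s = all (length s) then {[]} else {})"
    by auto
  then show ?case
    by simp
next
  case (Suc k)
  let ?P = "\<lambda>s. {u. length u = k \<and> path s u (all (length s))}"
  have fin: "finite (?P s)" for s
    by (rule finite_subset[of _ "{u. set u \<subseteq> {..<length s} \<and> length u = k}"])
      (use path_set in \<open>auto simp: finite_lists_length_eq\<close>)
  have "{u. length u = Suc k \<and> path s u (all (length s))} =
      (\<Union>x\<in>{x. allowed s x}. (#) x ` ?P (s[x := True]))"
    by (auto simp: length_Suc_conv)
  moreover have "finite {x. allowed s x}"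
    by (rule finite_subset[of _ "{..<length s}"]) (auto simp: allowed_def)
  ultimately have "card {u. length u = Suc k \<and> path s u (all (length s))} =
      (\<Sum>x | allowed s x. card ((#) x ` ?P (s[x := True])))"
    using fin[of "s[_ := True]"] by (simp only:, intro card_UN_disjoint) auto
  also have "\<dots> = (\<Sum>x | allowed s x. completions k (s[x := True]))"
    unfolding Suc.IH by (intro sum.cong refl card_image) simp
  also have "\<dots> = (\<Sum>t\<in>succs [] s. completions k t)"
  proof -
    \<comment> \<open>Distinct entries lead to distinct states, so the sum over the set of
      successors counts every entry once.\<close>
    have "inj_on (\<lambda>x. s[x := True]) {x. allowed s x}"
    proof (rule inj_onI)
      fix x y assume "x \<in> {x. allowed s x}" "y \<in> {x. allowed s x}" "s[x := True] = s[y := True]"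
      then show "x = y"
        by (metis allowed_def mem_Collect_eq nth_list_update_eq nth_list_update_neq)
    qed
    then show ?thesis
      unfolding succs_Nil by (simp add: sum.reindex)
  qed
  finally show ?case by simp
qed

lemma path_none_all_length: "path (none n) u (all n) \<Longrightarrow> length u = n"
  using path_all_iff[of "none n" u] distinct_card[of u]
  by (auto cong: conj_cong)

lemma theta_eq_completions: "theta n = completions n (none n)"
  unfolding theta_eq_card_paths completions_eq_card
  by (rule arg_cong[where f = card]) (auto dest: path_none_all_length)

section \<open>Sets of states as binary tries\<close>

text \<open>A branch spells a state, left for \<open>False\<close>, and its leaf stores a
  multiplicity. Stored multiplicities are positive, hence the type \<open>num\<close>, whose
  arithmetic is binary.\<close>

datatype trie = Empty | Leaf num | Node trie trie

text \<open>All leaves lie at depth \<open>n\<close>; this excludes the cases of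
  \<open>merge\<close> in which a leaf meets an inner node.\<close>

fun uniform :: "nat \<Rightarrow> trie \<Rightarrow> bool" where
  "uniform n Empty \<longleftrightarrow> True"
| "uniform n (Leaf c) \<longleftrightarrow> n = 0"
| "uniform n (Node l r) \<longleftrightarrow> (\<exists>m. n = Suc m \<and> uniform m l \<and> uniform m r)"

fun keys :: "trie \<Rightarrow> bool list set" where
  "keys Empty = {}"
| "keys (Leaf c) = {[]}"
| "keys (Node l r) = (#) False ` keys l \<union> (#) True ` keys r"

text \<open>The sum of \<open>f\<close> over the stored states with multiplicity. Each trie
  operation is specified by its effect on \<open>weight f\<close> for arbitrary \<open>f\<close>,
  which determines counts and membership at once.\<close>

fun weight :: "(bool list \<Rightarrow> nat) \<Rightarrow> trie \<Rightarrow> nat" where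
  "weight f Empty = 0"
| "weight f (Leaf c) = numeral c * f []"
| "weight f (Node l r) = weight (\<lambda>s. f (False # s)) l + weight (\<lambda>s. f (True # s)) r"

text \<open>Smart constructor: subtries without states collapse to \<open>Empty\<close>, so pruned
  branches vanish.\<close>

fun node :: "trie \<Rightarrow> trie \<Rightarrow> trie" where
  "node Empty Empty = Empty"
| "node Empty (Leaf c) = Node Empty (Leaf c)"
| "node Empty (Node l r) = Node Empty (Node l r)"
| "node (Leaf c) t = Node (Leaf c) t"
| "node (Node l r) t = Node (Node l r) t"

fun merge :: "trie \<Rightarrow> trie \<Rightarrow> trie" where
  "merge Empty t = t"
| "merge (Leaf c) Empty = Leaf c"
| "merge (Leaf c) (Leaf d) = Leaf (c + d)"
| "merge (Leaf c) (Node l r) = Node l r"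
| "merge (Node l r) Empty = Node l r"
| "merge (Node l r) (Leaf c) = Node l r"
| "merge (Node l r) (Node l' r') = Node (merge l l') (merge r r')"

fun mirror :: "bool list \<Rightarrow> trie \<Rightarrow> trie" where
  "mirror p Empty = Empty"
| "mirror p (Leaf c) = Leaf c"
| "mirror [] (Node l r) = Node l r"
| "mirror (False # p) (Node l r) = node (mirror p l) Empty"
| "mirror (True # p) (Node l r) = node Empty (mirror p r)"

text \<open>
  All states below a node share the prefix \<open>rev p\<close>, so the mirror condition for flipping the
  bit at this node selects a single branch of the left subtrie.
\<close>
fun step :: "bool list \<Rightarrow> trie \<Rightarrow> trie" where
  "step p Empty = Empty"
| "step p (Leaf c) = Empty"
| "step p (Node l r) = node (step (False # p) l) (merge (mirror p l) (step (True # p) r))"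

lemma weight_cong:
  "(\<And>s. s \<in> keys t \<Longrightarrow> f s = g s) \<Longrightarrow> weight f t = weight g t"
proof (induction t arbitrary: f g)
  case (Node l r)
  have "weight (\<lambda>s. f (False # s)) l = weight (\<lambda>s. g (False # s)) l"
    by (rule Node.IH(1)) (simp add: Node.prems)
  moreover have "weight (\<lambda>s. f (True # s)) r = weight (\<lambda>s. g (True # s)) r"
    by (rule Node.IH(2)) (simp add: Node.prems)
  ultimately show ?case by simp
qed simp_all

lemma weight_mono: "(\<And>s. f s \<le> g s) \<Longrightarrow> weight f t \<le> weight g t"
  by (induction t arbitrary: f g) (auto intro!: add_mono)

lemma weight_add: "weight (\<lambda>s. f s + g s) t = weight f t + weight g t"
  by (induction t arbitrary: f g) (auto simp: algebra_simps)

lemma weight_pos_iff: "0 < weight f t \<longleftrightarrow> (\<exists>s\<in>keys t. 0 < f s)"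
  by (induction t arbitrary: f) auto

text \<open>With an indicator function as \<open>f\<close>, every fact about \<open>weight\<close>
  turns into one about \<open>keys\<close>.\<close>

lemma in_keys_iff: "s \<in> keys t \<longleftrightarrow> 0 < weight (\<lambda>x. of_bool (x = s)) t"
  by (simp add: weight_pos_iff)

lemma weight_zero [simp]: "weight (\<lambda>s. 0) t = 0"
  by (induction t) auto

lemma length_keys: "uniform n t \<Longrightarrow> s \<in> keys t \<Longrightarrow> length s = n"
  by (induction t arbitrary: n s) auto

lemma weight_node [simp]: "weight f (node l r) = weight f (Node l r)"
  by (cases "(l, r)" rule: node.cases) auto

lemma uniform_node: "uniform n l \<Longrightarrow> uniform n r \<Longrightarrow> uniform (Suc n) (node l r)"
  by (cases "(l, r)" rule: node.cases) auto

lemma weight_merge: "uniform n t \<Longrightarrow> uniform n u \<Longrightarrow> weight f (merge t u) = weight f t + weight f u"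
proof (induction t u arbitrary: n f rule: merge.induct)
  case (7 l r l' r')
  then obtain m where "uniform m l" "uniform m r" "uniform m l'" "uniform m r'"
    by auto
  then show ?case
    using 7(1,2)[of m] by simp
qed (auto simp flip: add_mult_distrib)

lemma uniform_merge: "uniform n t \<Longrightarrow> uniform n u \<Longrightarrow> uniform n (merge t u)"
  by (induction t u arbitrary: n rule: merge.induct) auto

lemma keys_merge: "uniform n t \<Longrightarrow> uniform n u \<Longrightarrow> keys (merge t u) = keys t \<union> keys u"
  unfolding set_eq_iff Un_iff in_keys_iff by (simp add: weight_merge)

lemma weight_mirror: "weight f (mirror p t) = weight (\<lambda>r. if mirrored p r then f r else 0) t"
proof (induction p t arbitrary: f rule: mirror.induct)
  case (2 p c)
  then show ?case by (cases p) auto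
qed auto

lemma uniform_mirror: "uniform n t \<Longrightarrow> uniform n (mirror p t)"
  by (induction p t arbitrary: n rule: mirror.induct) (auto intro: uniform_node)

lemma uniform_step: "uniform n t \<Longrightarrow> uniform n (step p t)"
  by (induction p t arbitrary: n rule: step.induct) (auto intro!: uniform_node uniform_merge uniform_mirror)

lemma weight_step: "uniform n t \<Longrightarrow> weight f (step p t) = weight (\<lambda>r. \<Sum>s\<in>succs p r. f s) t"
proof (induction p t arbitrary: n f rule: step.induct)
  case (3 p l r)
  then obtain m where m: "uniform m l" "uniform m r"
    by auto
  \<comment> \<open>Setting the head bit gives a state that starts with \<open>True\<close>, all
    other successors start with \<open>False\<close>, so the sum splits.\<close>
  have F: "(\<Sum>s\<in>succs p (False # x). f s) =
      (if mirrored p x then f (True # x) else 0) + (\<Sum>s\<in>succs (False # p) x. f (False # s))" for x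
    by (simp, subst sum.insert) (auto simp: finite_succs sum.reindex)
  have T: "(\<Sum>s\<in>succs p (True # x). f s) = (\<Sum>s\<in>succs (True # p) x. f (True # s))" for x
    by (simp add: sum.reindex)
  show ?case
    using 3 m by (simp del: succs.simps add: F T weight_add weight_merge[where n = m] uniform_mirror uniform_step weight_mirror)
qed auto

lemma keys_step: "uniform n t \<Longrightarrow> keys (step p t) = (\<Union>r\<in>keys t. succs p r)"
proof (rule set_eqI)
  fix s assume t: "uniform n t"
  have "0 < (\<Sum>x\<in>succs p r. of_bool (x = s) :: nat) \<longleftrightarrow> s \<in> succs p r" for r
    by (simp add: finite_succs card_gt_0_iff)
  then show "s \<in> keys (step p t) \<longleftrightarrow> s \<in> (\<Union>r\<in>keys t. succs p r)"
    using t by (simp add: in_keys_iff weight_step) (simp add: weight_pos_iff)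
qed

section \<open>Pruning\<close>

text \<open>A leaf accepts every continuation, so a trie of states of length m tests a longer state
  through its first m bits.\<close>

fun mem :: "bool list \<Rightarrow> trie \<Rightarrow> bool" where
  "mem s Empty \<longleftrightarrow> False"
| "mem s (Leaf c) \<longleftrightarrow> True"
| "mem [] (Node l r) \<longleftrightarrow> False"
| "mem (b # s) (Node l r) \<longleftrightarrow> mem s (if b then r else l)"

text \<open>The two tries swap roles at each bit: bits at even positions descend in
  \<open>a\<close>, those at odd positions in \<open>b\<close>. Accepting at the first leaf met only
  weakens the test.\<close>

fun mem_alternating :: "bool list \<Rightarrow> trie \<Rightarrow> trie \<Rightarrow> bool" where
  "mem_alternating [] a b \<longleftrightarrow> True"
| "mem_alternating (x # s) Empty b \<longleftrightarrow> False"
| "mem_alternating (x # s) (Leaf c) b \<longleftrightarrow> True"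
| "mem_alternating (x # s) (Node l r) b \<longleftrightarrow> mem_alternating s b (if x then r else l)"

fun restrict :: "trie \<Rightarrow> trie \<Rightarrow> trie" where
  "restrict t (Leaf c) = t"
| "restrict t Empty = Empty"
| "restrict Empty (Node a b) = Empty"
| "restrict (Leaf c) (Node a b) = Empty"
| "restrict (Node l r) (Node a b) = node (restrict l a) (restrict r b)"

fun restrict_from :: "nat \<Rightarrow> trie \<Rightarrow> trie \<Rightarrow> trie" where
  "restrict_from 0 u t = restrict t u"
| "restrict_from (Suc k) u Empty = Empty"
| "restrict_from (Suc k) u (Leaf c) = Leaf c"
| "restrict_from (Suc k) u (Node l r) = node (restrict_from k u l) (restrict_from k u r)"

fun restrict_alternating :: "trie \<Rightarrow> trie \<Rightarrow> trie \<Rightarrow> trie" where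
  "restrict_alternating Empty a b = Empty"
| "restrict_alternating (Leaf c) a b = Leaf c"
| "restrict_alternating (Node l r) Empty b = Empty"
| "restrict_alternating (Node l r) (Leaf c) b = Node l r"
| "restrict_alternating (Node l r) (Node u v) b =
     node (restrict_alternating l b u) (restrict_alternating r b v)"

definition prune :: "nat \<Rightarrow> trie \<Rightarrow> trie \<Rightarrow> trie" where
  "prune k u t = restrict (restrict_from k u (restrict_alternating t u u)) u"

text \<open>For length 2 * m and k = m these are tests on the two halves and on the two residue
  classes modulo 2.\<close>

definition passes :: "nat \<Rightarrow> trie \<Rightarrow> bool list \<Rightarrow> bool" where
  "passes k u s \<longleftrightarrow>
     mem s u \<and> (k \<le> length s \<longrightarrow> mem (drop k s) u) \<and> mem_alternating s u u"

lemma weight_restrict: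
  "weight f (restrict t u) = weight (\<lambda>s. if mem s u then f s else 0) t"
  by (induction t u arbitrary: f rule: restrict.induct) auto

lemma uniform_restrict: "uniform n t \<Longrightarrow> uniform n (restrict t u)"
  by (induction t u arbitrary: n rule: restrict.induct) (auto intro: uniform_node)

lemma weight_restrict_from:
  "weight f (restrict_from k u t) =
     weight (\<lambda>s. if k \<le> length s \<longrightarrow> mem (drop k s) u then f s else 0) t"
  by (induction k u t arbitrary: f rule: restrict_from.induct) (auto simp: weight_restrict)

lemma uniform_restrict_from: "uniform n t \<Longrightarrow> uniform n (restrict_from k u t)"
  by (induction k u t arbitrary: n rule: restrict_from.induct)
    (auto intro: uniform_node uniform_restrict)

lemma weight_restrict_alternating:
  "weight f (restrict_alternating t a b) =
     weight (\<lambda>s. if mem_alternating s a b then f s else 0) t"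
  by (induction t a b arbitrary: f rule: restrict_alternating.induct) auto

lemma uniform_restrict_alternating: "uniform n t \<Longrightarrow> uniform n (restrict_alternating t a b)"
  by (induction t a b arbitrary: n rule: restrict_alternating.induct) (auto intro: uniform_node)

lemma weight_prune: "weight f (prune k u t) = weight (\<lambda>s. if passes k u s then f s else 0) t"
  unfolding prune_def weight_restrict weight_restrict_from weight_restrict_alternating
  by (rule weight_cong) (auto simp: passes_def)

lemma uniform_prune: "uniform n t \<Longrightarrow> uniform n (prune k u t)"
  by (simp add: prune_def uniform_restrict uniform_restrict_from uniform_restrict_alternating)

lemma keys_prune: "keys (prune k u t) = {s \<in> keys t. passes k u s}"
  unfolding set_eq_iff by (simp add: in_keys_iff weight_prune) (auto simp: weight_pos_iff)

section \<open>The computation level by level\<close>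

fun initial :: "nat \<Rightarrow> trie" where
  "initial 0 = Leaf num.One"
| "initial (Suc n) = Node (initial n) Empty"

lemma uniform_initial: "uniform n (initial n)"
  by (induction n) auto

lemma keys_initial: "keys (initial n) = {none n}"
  by (induction n) auto

lemma weight_initial: "weight f (initial n) = f (none n)"
  by (induction n arbitrary: f) auto

fun run :: "nat \<Rightarrow> nat \<Rightarrow> trie \<Rightarrow> trie \<Rightarrow> trie" where
  "run 0 k u t = t"
| "run (Suc i) k u t = run i k u (prune k u (step [] t))"

text \<open>States of all levels have the same length, so a single trie can hold them all.\<close>

fun visited :: "nat \<Rightarrow> nat \<Rightarrow> trie \<Rightarrow> trie \<Rightarrow> trie" where
  "visited 0 k u t = t"
| "visited (Suc i) k u t = merge t (visited i k u (prune k u (step [] t)))"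

lemma uniform_run: "uniform n t \<Longrightarrow> uniform n (run i k u t)"
  by (induction i arbitrary: t) (auto simp: uniform_prune uniform_step)

text \<open>A step preserves the total number of completions and pruning can only lower it, whatever
  the filter \<open>u\<close>.\<close>

lemma weight_run_le:
  "uniform n t \<Longrightarrow> weight (completions 0) (run i k u t) \<le> weight (completions i) t"
proof (induction i arbitrary: t)
  case (Suc i)
  let ?t = "prune k u (step [] t)"
  have "weight (completions i) ?t \<le> weight (completions i) (step [] t)"
    unfolding weight_prune by (rule weight_mono) simp
  also have "\<dots> = weight (completions (Suc i)) t"
    unfolding weight_step[OF Suc.prems] by (rule weight_cong) simp
  finally have "weight (completions i) ?t \<le> weight (completions (Suc i)) t" .
  moreover have "weight (completions 0) (run i k u ?t) \<le> weight (completions i) ?t"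
    by (rule Suc.IH) (simp add: uniform_prune uniform_step Suc.prems)
  ultimately show ?case
    unfolding run.simps by (rule le_trans[rotated])
qed simp

text \<open>An executable check that only the full state is left. The value is an \<open>int\<close>
  because integer numerals are evaluated in binary.\<close>

fun full_with :: "int \<Rightarrow> trie \<Rightarrow> bool" where
  "full_with v (Leaf c) \<longleftrightarrow> numeral c = v"
| "full_with v (Node Empty r) \<longleftrightarrow> full_with v r"
| "full_with v t \<longleftrightarrow> False"

lemma weight_full_with:
  "uniform n t \<Longrightarrow> full_with v t \<Longrightarrow> int (weight (completions 0) t) = v"
proof -
  have "uniform n t \<Longrightarrow> full_with v t \<Longrightarrow> int (weight f t) = v * int (f (all n))" for f
    by (induction v t arbitrary: n f rule: full_with.induct) auto
  from this[of "completions 0"]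
  show "uniform n t \<Longrightarrow> full_with v t \<Longrightarrow> int (weight (completions 0) t) = v"
    by simp
qed

lemma theta_ge:
  assumes "full_with v (run n k u (initial n))"
  shows "v \<le> int (theta n)"
proof -
  have "int (weight (completions 0) (run n k u (initial n))) = v"
    using assms weight_full_with uniform_run uniform_initial by blast
  then show ?thesis
    using weight_run_le[OF uniform_initial, where n = n and i = n and k = k and u = u]
    by (simp add: theta_eq_completions weight_initial)
qed

section \<open>States on a path from the empty to the full state\<close>

definition live :: "nat \<Rightarrow> bool list \<Rightarrow> bool" where
  "live n s \<longleftrightarrow> (\<exists>u v. path (none n) u s \<and> path s v (all n))"

lemma live_length: "live n s \<Longrightarrow> length s = n"
  unfolding live_def by (auto dest: path_length)

definition subprogression :: "nat \<Rightarrow> nat \<Rightarrow> nat \<Rightarrow> bool list \<Rightarrow> bool list" where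
  "subprogression a b m s = map (\<lambda>i. s ! (a + b * i)) [0..<m]"

lemma length_subprogression [simp]: "length (subprogression a b m s) = m"
  by (simp add: subprogression_def)

text \<open>Distance \<open>d\<close> in the trace is distance \<open>b * d\<close> in
  \<open>s\<close>, so an entry on the progression stays allowed in the trace; an entry off it
  leaves the trace unchanged.\<close>

lemma path_subprogression:
  assumes b: "0 < b" and bound: "\<And>i. i < m \<Longrightarrow> a + b * i < n"
  shows "length s = n \<Longrightarrow> path s u t \<Longrightarrow>
    \<exists>u'. path (subprogression a b m s) u' (subprogression a b m t)"
proof (induction u arbitrary: s)
  case Nil
  then show ?case by (auto intro: exI[of _ "[]"])
next
  case (Cons x u)
  let ?R = "subprogression a b m"
  obtain u' where u': "path (?R (s[x := True])) u' (?R t)"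
    using Cons.IH[of "s[x := True]"] Cons.prems by auto
  show ?case
  proof (cases "\<exists>i<m. x = a + b * i")
    case True
    then obtain i where i: "i < m" "x = a + b * i" by blast
    have "?R (s[x := True]) = (?R s)[i := True]"
      using i b bound Cons.prems by (auto simp: subprogression_def list_eq_iff_nth_eq nth_list_update)
    moreover have "allowed (?R s) i"
      unfolding allowed_def
    proof (intro conjI allI impI)
      have al: "allowed s x"
        using Cons.prems by simp
      show "i < length (?R s)" "\<not> ?R s ! i"
        using i al by (auto simp: subprogression_def allowed_def)
      fix d assume d: "d \<le> i" "i + d < length (?R s)"
      have "x - b * d = a + b * (i - d)" "x + b * d = a + b * (i + d)" "b * d \<le> x"
        unfolding i(2) using mult_le_mono2[OF d(1), of b]
        by (simp_all only: diff_mult_distrib2 distrib_left)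
      moreover have "a + b * (i + d) < length s"
        using bound[of "i + d"] d(2) Cons.prems(1) by simp
      ultimately have "s ! (a + b * (i - d)) = s ! (a + b * (i + d))"
        using al unfolding allowed_def by metis
      then show "?R s ! (i - d) = ?R s ! (i + d)"
        using d i by (simp add: subprogression_def)
    qed
    ultimately have "path (?R s) (i # u') (?R t)"
      using u' by simp
    then show ?thesis by blast
  next
    case False
    then have "?R (s[x := True]) = ?R s"
      by (auto simp: subprogression_def list_eq_iff_nth_eq nth_list_update)
    then show ?thesis using u' by auto
  qed
qed

lemma live_subprogression:
  assumes b: "0 < b" and bound: "\<And>i. i < m \<Longrightarrow> a + b * i < n" and s: "live n s"
  shows "live m (subprogression a b m s)"
proof -
  have "subprogression a b m (none n) = none m" "subprogression a b m (all n) = all m"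
    using bound by (auto simp: subprogression_def list_eq_iff_nth_eq)
  then show ?thesis
    using s path_subprogression[OF b bound] live_length[OF s] unfolding live_def
    by (metis length_replicate)
qed

text \<open>Reversing a permutation preserves 3-freeness. Complementing all bits respects the
  symmetry condition, and the centre is compared only with itself.\<close>

lemma path_complement: "path s u t \<Longrightarrow> path (map Not t) (rev u) (map Not s)"
proof (induction u arbitrary: s)
  case (Cons x u)
  have x: "allowed s x"
    using Cons.prems by simp
  then have "(map Not (s[x := True]))[x := True] = map Not s"
    by (auto simp: allowed_def list_eq_iff_nth_eq nth_list_update)
  moreover have "allowed (map Not (s[x := True])) x"
    using x by (auto simp: allowed_def nth_list_update)
  ultimately show ?case
    using Cons by (auto simp: path_append)
qed simp

lemma live_complement: "live n s \<Longrightarrow> live n (map Not s)"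
  unfolding live_def using path_complement by fastforce

section \<open>Filters that keep all live states\<close>

definition complete :: "nat \<Rightarrow> trie \<Rightarrow> bool" where
  "complete m u \<longleftrightarrow> (\<forall>s. live m s \<longrightarrow> mem s u)"

definition sound :: "nat \<Rightarrow> nat \<Rightarrow> trie \<Rightarrow> bool" where
  "sound n k u \<longleftrightarrow> (\<forall>s. live n s \<longrightarrow> passes k u s)"

lemma mem_append: "mem s u \<Longrightarrow> mem (s @ t) u"
  by (induction s u rule: mem.induct) auto

fun evens :: "bool list \<Rightarrow> bool list" where
  "evens [] = []"
| "evens (x # s) = x # evens (tl s)"

lemma mem_evens: "mem (evens s) a \<Longrightarrow> mem (evens (tl s)) b \<Longrightarrow> mem_alternating s a b"
  by (induction s a b rule: mem_alternating.induct) auto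

lemma evens_eq: "length s = 2 * m \<Longrightarrow> evens s = subprogression 0 2 m s"
proof (induction m arbitrary: s)
  case (Suc m)
  then obtain x y r where "s = x # y # r" "length r = 2 * m"
    by (auto simp: length_Suc_conv)
  then show ?case
    using Suc.IH[of r] by (simp add: subprogression_def map_upt_Suc del: upt_Suc)
qed (simp add: subprogression_def)

lemma evens_tl_eq: "length s = 2 * m \<Longrightarrow> evens (tl s) = subprogression 1 2 m s"
proof (induction m arbitrary: s)
  case (Suc m)
  then obtain x y r where "s = x # y # r" "length r = 2 * m"
    by (auto simp: length_Suc_conv)
  then show ?case
    using Suc.IH[of r] by (simp add: subprogression_def map_upt_Suc del: upt_Suc)
qed (simp add: subprogression_def)

text \<open>The tests of \<open>passes\<close> look at the traces on the subprogressions with (a, b)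
  = (0, 1), (m, 1), (0, 2) and (1, 2), which are live at length \<open>m\<close>.\<close>

lemma sound_if_complete:
  assumes "complete m u"
  shows "sound (2 * m) m u"
  unfolding sound_def
proof (intro allI impI)
  fix s assume s: "live (2 * m) s"
  have len: "length s = 2 * m"
    using live_length[OF s] .
  have sub: "mem (subprogression a b m s) u" if "0 < b" "\<And>i. i < m \<Longrightarrow> a + b * i < 2 * m" for a b
    using live_subprogression[OF that s] assms unfolding complete_def by blast
  have "subprogression 0 1 m s = take m s" "subprogression m 1 m s = drop m s"
    using len by (auto simp: subprogression_def list_eq_iff_nth_eq)
  then have "mem (take m s) u" "mem (drop m s) u"
    using sub[of 1 0] sub[of 1 m] by auto
  moreover have "mem (evens s) u" "mem (evens (tl s)) u"
    using sub[of 2 0] sub[of 2 1] by (auto simp: evens_eq[OF len] evens_tl_eq[OF len])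
  ultimately show "passes m u s"
    using mem_append[of "take m s" u "drop m s"] mem_evens by (simp add: passes_def)
qed

text \<open>A leaf accepts everything: the trivial filter from which the tables are
  bootstrapped.\<close>

lemma sound_Leaf: "sound n k (Leaf c)"
proof -
  have "mem_alternating s (Leaf c) (Leaf c)" for s
    by (cases s) auto
  then show ?thesis
    by (simp add: sound_def passes_def)
qed

text \<open>Every state that occurs is reachable. If it also has a completion it is live and passes,
  so pruning discards only states without completions.\<close>

lemma weight_run:
  assumes u: "sound n k u"
  shows "uniform n t \<Longrightarrow> (\<And>s. s \<in> keys t \<Longrightarrow> \<exists>v. path (none n) v s) \<Longrightarrow>
    weight (completions 0) (run i k u t) = weight (completions i) t"
proof (induction i arbitrary: t)
  case (Suc i)
  let ?t = "prune k u (step [] t)"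
  have reach: "\<exists>v. path (none n) v s" if s: "s \<in> keys (step [] t)" for s
  proof -
    obtain r where r: "r \<in> keys t" "s \<in> succs [] r"
      using s keys_step[OF Suc.prems(1)] by auto
    obtain x where "path r [x] s"
      using r(2) by (auto simp: succs_Nil)
    then show ?thesis
      using Suc.prems(2)[OF r(1)] path_append by blast
  qed
  have "weight (completions i) ?t = weight (completions i) (step [] t)"
    unfolding weight_prune
  proof (rule weight_cong)
    fix s assume s: "s \<in> keys (step [] t)"
    have "\<not> live n s" if "\<not> passes k u s"
      using that u by (auto simp: sound_def)
    moreover have "live n s" if pos: "completions i s > 0"
    proof -
      have "length s = n"
        using length_keys[OF uniform_step[OF Suc.prems(1)] s] .
      moreover obtain v where "path s v (all (length s))"
        using pos unfolding completions_eq_card card_gt_0_iff by auto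
      ultimately show ?thesis
        using reach[OF s] by (auto simp: live_def)
    qed
    ultimately show "(if passes k u s then completions i s else 0) = completions i s"
      by auto
  qed
  also have "\<dots> = weight (completions (Suc i)) t"
    unfolding weight_step[OF Suc.prems(1)] by (rule weight_cong) simp
  finally have "weight (completions i) ?t = weight (completions (Suc i)) t" .
  moreover have "weight (completions 0) (run i k u ?t) = weight (completions i) ?t"
    using Suc.prems(1) reach by (intro Suc.IH) (auto simp: uniform_prune uniform_step keys_prune)
  ultimately show ?case
    unfolding run.simps by (rule trans[rotated])
qed simp

lemma theta_eq:
  assumes u: "sound n k u" and v: "full_with v (run n k u (initial n))"
  shows "int (theta n) = v"
proof -
  have "int (weight (completions 0) (run n k u (initial n))) = v"
    using v weight_full_with uniform_run uniform_initial by blast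
  moreover have "\<exists>v. path (none n) v (none n)"
    by (rule exI[of _ "[]"]) simp
  ultimately show ?thesis
    using weight_run[OF u uniform_initial, where i = n]
    by (simp add: theta_eq_completions weight_initial keys_initial)
qed

section \<open>Tables of live states\<close>

lemma uniform_visited: "uniform n t \<Longrightarrow> uniform n (visited i k u t)"
  by (induction i arbitrary: t) (auto simp: uniform_prune uniform_step uniform_merge)

text \<open>Follow the path \<open>v\<close> from \<open>r\<close>: each state on it is live because
  \<open>s\<close> is, hence survives the pruning.\<close>

lemma in_keys_visited:
  assumes u: "sound n k u"
  shows "uniform n t \<Longrightarrow> r \<in> keys t \<Longrightarrow> path (none n) w r \<Longrightarrow> path r v s \<Longrightarrow> live n s \<Longrightarrow>
    length v \<le> i \<Longrightarrow> s \<in> keys (visited i k u t)"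
proof (induction i arbitrary: t r w v)
  case (Suc i)
  let ?t = "prune k u (step [] t)"
  have m: "keys (visited (Suc i) k u t) = keys t \<union> keys (visited i k u ?t)"
    using Suc.prems(1) by (simp add: keys_merge[where n = n] uniform_visited uniform_prune uniform_step)
  show ?case
  proof (cases v)
    case Nil
    then show ?thesis
      using Suc.prems m by auto
  next
    case (Cons x v')
    let ?r = "r[x := True]"
    have r: "allowed r x" "path ?r v' s"
      using Suc.prems(4) Cons by auto
    have w: "path (none n) (w @ [x]) ?r"
      using Suc.prems(3) r(1) by (auto simp: path_append)
    have "live n ?r"
      using w r(2) Suc.prems(5) path_append unfolding live_def by blast
    then have "passes k u ?r"
      using u by (simp add: sound_def)
    moreover have "?r \<in> keys (step [] t)"
      using Suc.prems(1,2) r(1) by (auto simp: keys_step succs_Nil)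
    ultimately have "s \<in> keys (visited i k u ?t)"
      using Suc.prems Cons w r(2)
      by (intro Suc.IH[of ?t ?r "w @ [x]" v']) (auto simp: keys_prune uniform_prune uniform_step)
    then show ?thesis
      using m by blast
  qed
qed simp

text \<open>The states of one trie whose complement lies in the other. A state can be completed iff
  its complement is reachable, so meeting the visited states with their complements removes dead
  ends.\<close>

fun both_live :: "trie \<Rightarrow> trie \<Rightarrow> trie" where
  "both_live Empty t = Empty"
| "both_live (Leaf c) (Leaf d) = Leaf num.One"
| "both_live (Leaf c) Empty = Empty"
| "both_live (Leaf c) (Node l r) = Empty"
| "both_live (Node l r) Empty = Empty"
| "both_live (Node l r) (Leaf c) = Empty"
| "both_live (Node l r) (Node l' r') = node (both_live l r') (both_live r l')"

lemma mem_node [simp]: "mem s (node l r) = mem s (Node l r)"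
  by (cases "(l, r)" rule: node.cases; cases s) auto

lemma mem_both_live: "s \<in> keys t \<Longrightarrow> map Not s \<in> keys u \<Longrightarrow> mem s (both_live t u)"
  by (induction t u arbitrary: s rule: both_live.induct) auto

definition live_states :: "nat \<Rightarrow> nat \<Rightarrow> trie \<Rightarrow> trie" where
  "live_states n k u = (let t = visited n k u (initial n) in both_live t t)"

lemma complete_live_states:
  assumes u: "sound n k u"
  shows "complete n (live_states n k u)"
proof -
  let ?t = "visited n k u (initial n)"
  have "s \<in> keys ?t" if s: "live n s" for s
  proof -
    obtain v w where vw: "path (none n) v s" "path s w (all n)"
      using s by (auto simp: live_def)
    then have "length (v @ w) = n"
      by (intro path_none_all_length) (auto simp: path_append)
    then show ?thesis
      using vw(1) s in_keys_visited[OF u uniform_initial, where r = "none n" and w = "[]" and v = v and s = s and i = n]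
      by (simp add: keys_initial)
  qed
  then show ?thesis
    by (auto simp: complete_def live_states_def Let_def intro!: mem_both_live live_complement)
qed

section \<open>Doubling\<close>

text \<open>The outer terms of a progression have equal parity, hence lie in the same block, and so
  does the term placed between them.\<close>

lemma three_free_append:
  assumes xs: "three_free xs" "\<And>x. x \<in> set xs \<Longrightarrow> even x = b"
    and ys: "three_free ys" "\<And>y. y \<in> set ys \<Longrightarrow> even y \<noteq> b"
  shows "three_free (xs @ ys)"
  unfolding three_free_def
proof clarify
  fix i j k
  let ?z = "xs @ ys" and ?l = "length xs"
  assume ijk: "i < j" "j < k" "k < length ?z" and ap: "?z ! i + ?z ! k = 2 * ?z ! j"
  have par: "even (?z ! m) = b \<longleftrightarrow> m < ?l" if "m < length ?z" for m
    using that xs(2) ys(2) by (auto simp: nth_append)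
  have "even (?z ! i) = even (?z ! k)"
    using ap by (metis dvd_triv_left even_add)
  then have same: "i < ?l \<longleftrightarrow> k < ?l"
    using par[of i] par[of k] ijk by auto
  show False
  proof (cases "k < ?l")
    case True
    then have "xs ! i + xs ! k = 2 * xs ! j"
      using ap ijk by (simp add: nth_append)
    then show False
      using xs(1) ijk True unfolding three_free_def by blast
  next
    case False
    then have ge: "?l \<le> i"
      using same by simp
    then have "ys ! (i - ?l) + ys ! (k - ?l) = 2 * ys ! (j - ?l)"
      using ap ijk by (simp add: nth_append)
    moreover have "i - ?l < j - ?l" "j - ?l < k - ?l" "k - ?l < length ys"
      using ge ijk by auto
    ultimately show False
      using ys(1) unfolding three_free_def by blast
  qed
qed

text \<open>The form \<open>f x + c = d * x\<close> covers 2 * x - 1 without truncated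
  subtraction.\<close>

lemma three_free_map_affine:
  assumes f: "\<And>x. x \<in> set u \<Longrightarrow> f x + c = d * x" and d: "0 < d" and u: "three_free u"
  shows "three_free (map f u)"
  unfolding three_free_def
proof clarify
  fix i j k
  assume ijk: "i < j" "j < k" "k < length (map f u)"
    and ap: "map f u ! i + map f u ! k = 2 * map f u ! j"
  have "d * u ! m = f (u ! m) + c" if "m < length u" for m
    using that f by simp
  then have "d * u ! i + d * u ! k = 2 * (d * u ! j)"
    using ap ijk by simp
  then have "d * (u ! i + u ! k) = d * (2 * u ! j)"
    by (simp add: algebra_simps)
  then have "u ! i + u ! k = 2 * u ! j"
    using d by simp
  then show False
    using u ijk unfolding three_free_def by auto
qed

lemma theta_doubling:
  assumes n: "2 \<le> n"
  shows "2 * theta (n div 2) * theta ((n + 1) div 2) \<le> theta n"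
proof -
  define P where "P m = {a \<in> permutations_of_set {1..m}. three_free a}" for m :: nat
  define p q where "p = (n + 1) div 2" and "q = n div 2"
  define dbl where "dbl = map (\<lambda>x. 2 * x :: nat)"
  define odd' where "odd' = map (\<lambda>x. 2 * x - 1 :: nat)"
  have P: "a \<in> P m \<longleftrightarrow> distinct a \<and> set a = {1..m} \<and> three_free a" for a m
    by (auto simp: P_def permutations_of_set_def)
  have finP: "finite (P m)" for m
    by (simp add: P_def)
  have dbl: "distinct (dbl b)" "three_free (dbl b)" "set (dbl b) = {x \<in> {1..n}. even x}"
    if b: "b \<in> P q" for b
  proof -
    show "distinct (dbl b)"
      using b by (simp add: P dbl_def distinct_map inj_on_def)
    show "three_free (dbl b)"
      unfolding dbl_def using b by (intro three_free_map_affine[where c = 0 and d = 2]) (auto simp: P)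
    show "set (dbl b) = {x \<in> {1..n}. even x}"
    proof -
      have "{x \<in> {1..n}. even x} = (\<lambda>x. 2 * x) ` {1..q}"
        by (auto simp: q_def elim!: evenE)
      then show ?thesis
        using b by (simp add: P dbl_def)
    qed
  qed
  have odd': "distinct (odd' a)" "three_free (odd' a)" "set (odd' a) = {x \<in> {1..n}. odd x}"
    if a: "a \<in> P p" for a
  proof -
    show "distinct (odd' a)"
      using a by (auto simp: P odd'_def distinct_map inj_on_def)
    show "three_free (odd' a)"
      unfolding odd'_def using a by (intro three_free_map_affine[where c = 1 and d = 2]) (auto simp: P)
    show "set (odd' a) = {x \<in> {1..n}. odd x}"
    proof -
      have "x \<in> (\<lambda>x. 2 * x - 1) ` {1..p}" if "odd x" "x \<le> n" for x
        using that by (intro image_eqI[of _ _ "(x + 1) div 2"]) (auto simp: p_def elim!: oddE)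
      then have "{x \<in> {1..n}. odd x} = (\<lambda>x. 2 * x - 1) ` {1..p}"
        by (auto simp: p_def)
      then show ?thesis
        using a by (simp add: P odd'_def)
    qed
  qed
  define A where "A = (\<lambda>(a, b). odd' a @ dbl b) ` (P p \<times> P q)"
  define B where "B = (\<lambda>(a, b). dbl b @ odd' a) ` (P p \<times> P q)"
  have inj: "inj dbl" "inj_on odd' (P p)"
  proof -
    show "inj dbl"
      unfolding dbl_def by (intro inj_mapI injI) simp
    show "inj_on odd' (P p)"
      unfolding odd'_def by (rule inj_on_mapI) (auto simp: P inj_on_def)
  qed
  \<comment> \<open>Fixed block lengths make the concatenations uniquely splittable, hence injective
    in the pair of blocks.\<close>
  have len: "length (odd' a) = p" "length (dbl b) = q" if "a \<in> P p" "b \<in> P q" for a b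
    using that distinct_card[of a] distinct_card[of b] by (auto simp: P odd'_def dbl_def)
  have "inj_on (\<lambda>(a, b). odd' a @ dbl b) (P p \<times> P q)"
    using inj len by (auto simp: inj_on_def)
  then have cA: "card A = theta p * theta q"
    by (simp add: A_def card_image card_cartesian_product theta_def P_def)
  have "inj_on (\<lambda>(a, b). dbl b @ odd' a) (P p \<times> P q)"
    using inj len by (auto simp: inj_on_def)
  then have cB: "card B = theta p * theta q"
    by (simp add: B_def card_image card_cartesian_product theta_def P_def)
  have sub: "A \<union> B \<subseteq> P n"
  proof -
    have "odd' a @ dbl b \<in> P n \<and> dbl b @ odd' a \<in> P n" if "a \<in> P p" "b \<in> P q" for a b
    proof -
      have "three_free (odd' a @ dbl b)"
        using dbl[OF that(2)] odd'[OF that(1)] by (intro three_free_append[where b = False]) auto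
      moreover have "three_free (dbl b @ odd' a)"
        using dbl[OF that(2)] odd'[OF that(1)] by (intro three_free_append[where b = True]) auto
      moreover have "set (odd' a) \<union> set (dbl b) = {1..n}" "set (odd' a) \<inter> set (dbl b) = {}"
        unfolding dbl(3)[OF that(2)] odd'(3)[OF that(1)] by auto
      ultimately show ?thesis
        using dbl(1)[OF that(2)] odd'(1)[OF that(1)] by (simp add: P Un_commute Int_commute)
    qed
    then show ?thesis
      by (auto simp: A_def B_def)
  qed
  \<comment> \<open>The parity of the first entry tells the two orders apart;
    \<open>2 \<le> n\<close> makes both blocks nonempty.\<close>
  have disj: "A \<inter> B = {}"
  proof -
    have "odd' a @ dbl b \<noteq> dbl b' @ odd' a'"
      if "a \<in> P p" "b \<in> P q" "a' \<in> P p" "b' \<in> P q" for a b a' b'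
    proof
      assume eq: "odd' a @ dbl b = dbl b' @ odd' a'"
      have ne: "odd' a \<noteq> []" "dbl b' \<noteq> []"
        using len[OF that(1,2)] len[OF that(3,4)] n by (auto simp: p_def q_def)
      then have "hd (odd' a) = hd (dbl b')"
        using arg_cong[OF eq, of hd] by simp
      moreover have "odd (hd (odd' a))" "even (hd (dbl b'))"
        using ne odd'(3)[OF that(1)] dbl(3)[OF that(4)] hd_in_set by blast+
      ultimately show False by simp
    qed
    then show ?thesis
      by (auto simp: A_def B_def)
  qed
  have "card (A \<union> B) = 2 * (theta p * theta q)"
    using cA cB disj finP by (subst card_Un_disjoint) (auto simp: A_def B_def)
  then have "2 * (theta p * theta q) \<le> card (P n)"
    using card_mono[OF finP sub] by simp
  then show ?thesis
    by (simp add: P_def theta_def p_def q_def mult_ac)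
qed

section \<open>Computed values\<close>

text \<open>A chain of doublings up to half of 40: length 5 is explored unpruned, and each table
  filters the next one.\<close>

definition live5 :: trie where "live5 = live_states 5 0 (Leaf num.One)"
definition live10 :: trie where "live10 = live_states 10 5 live5"
definition live20 :: trie where "live20 = live_states 20 10 live10"

lemma complete_live20: "complete 20 live20"
proof -
  have "complete 5 live5"
    unfolding live5_def by (intro complete_live_states sound_Leaf)
  then have "complete 10 live10"
    unfolding live10_def using sound_if_complete[of 5] by (intro complete_live_states) simp
  then show ?thesis
    unfolding live20_def using sound_if_complete[of 10] by (intro complete_live_states) simp
qed

lemma theta_ge_12_to_19:
  "6128 \<le> int (theta 12)" "12840 \<le> int (theta 13)" "29380 \<le> int (theta 14)"
  "74904 \<le> int (theta 15)" "212728 \<le> int (theta 16)" "368016 \<le> int (theta 17)"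
  "659296 \<le> int (theta 18)" "1371056 \<le> int (theta 19)"
  by (rule theta_ge[where k = 5 and u = live5], code_simp)+

text \<open>Lengths 22, 23 and 26 are computed because doubling the available bounds does not serve
  them: at 26, twice the bound for 13 gives a constant of only about 0.69. Length 20 is used for
  39.\<close>

lemma theta_ge_20_to_26:
  "2937136 \<le> int (theta 20)" "15616616 \<le> int (theta 22)"
  "38431556 \<le> int (theta 23)" "419141312 \<le> int (theta 26)"
  by (rule theta_ge[where k = 10 and u = live10], code_simp)+

text \<open>An equality requires a filter that loses no live state: \<open>live20\<close> is
  complete at length 20, hence sound at 40.\<close>

lemma theta_40: "int (theta 40) = 22388184630824"
proof (rule theta_eq)
  show "sound 40 20 live20"
    using sound_if_complete[OF complete_live20] by simp
  show "full_with 22388184630824 (run 40 20 live20 (initial 40))"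
    by code_simp
qed

lemma theta_ge_41: "50301508651032 \<le> int (theta 41)"
  by (rule theta_ge[where k = 20 and u = live20]) code_simp

lemma theta_ge_42: "113605533519568 \<le> int (theta 42)"
  by (rule theta_ge[where k = 20 and u = live20]) code_simp

lemma theta_ge_43: "265157938869936 \<le> int (theta 43)"
  by (rule theta_ge[where k = 20 and u = live20]) code_simp

section \<open>The lower bound\<close>

lemma doubling_bound:
  fixes a c d :: real
  assumes n: "2 \<le> n" and pos: "0 \<le> a" "0 \<le> c" "0 \<le> d"
    and p: "c * a ^ (n div 2) \<le> theta (n div 2)"
    and q: "d * a ^ ((n + 1) div 2) \<le> theta ((n + 1) div 2)"
  shows "2 * c * d * a ^ n \<le> theta n"
proof -
  have "a ^ n = a ^ (n div 2) * a ^ ((n + 1) div 2)"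
    unfolding power_add[symmetric] by (rule arg_cong[where f = "(^) a"]) linarith
  then have "2 * c * d * a ^ n = 2 * ((c * a ^ (n div 2)) * (d * a ^ ((n + 1) div 2)))"
    by simp
  also have "\<dots> \<le> 2 * (real (theta (n div 2)) * real (theta ((n + 1) div 2)))"
    using pos p q by (intro mult_left_mono mult_mono) auto
  also have "\<dots> = real (2 * theta (n div 2) * theta ((n + 1) div 2))"
    by simp
  also have "\<dots> \<le> theta n"
    using theta_doubling[OF n] by (simp only: of_nat_le_iff)
  finally show ?thesis .
qed

text \<open>Replaces an irrational base by a rational upper bound, which leaves an inequality
  between numerals.\<close>

lemma numeric_bound:
  fixes a c b :: real
  assumes "0 \<le> a" "a \<le> b" "0 \<le> c" "v \<le> int (theta n)" "c * b ^ n \<le> of_int v"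
  shows "c * a ^ n \<le> theta n"
proof -
  have "c * a ^ n \<le> c * b ^ n"
    using assms by (intro mult_left_mono power_mono) auto
  also have "\<dots> \<le> theta n"
    using assms(4,5) by linarith
  finally show ?thesis .
qed

theorem theorem11:
  fixes \<alpha> :: real
  defines "\<alpha> \<equiv> root 40 (real (theta 40))"
  shows "theta 40 = 22388184630824 \<and>
    (\<forall>p n :: nat. 2 \<le> p \<longrightarrow> 5 * 2 ^ (p + 1) \<le> n \<longrightarrow> n \<le> 5 * 2 ^ (p + 2) - 1 \<longrightarrow>
       real (theta n) \<ge> 2 ^ (2 ^ (p - 2) - 1) * \<alpha> ^ n)"
proof -
  have theta40: "theta 40 = 22388184630824"
    using theta_40 by linarith
  have \<alpha>40: "\<alpha> ^ 40 = theta 40"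
    by (simp add: \<alpha>_def)
  have \<alpha>0: "0 \<le> \<alpha>"
    by (simp add: \<alpha>_def)
  \<comment> \<open>2.1566 is a rational slightly above the 40th root.\<close>
  have "\<alpha> ^ 40 \<le> (2.1566 :: real) ^ 40"
    unfolding \<alpha>40 theta40 by (simp add: power_divide)
  then have \<alpha>1: "\<alpha> \<le> 2.1566"
    by (rule power_le_imp_le_base[of _ 39, simplified]) simp_all
  note small = numeric_bound[OF \<alpha>0 \<alpha>1]
  have doubled: "e * \<alpha> ^ n \<le> theta n"
    if "c * \<alpha> ^ i \<le> theta i" "d * \<alpha> ^ j \<le> theta j" "n div 2 = i" "(n + 1) div 2 = j"
      "2 \<le> n" "0 \<le> c" "0 \<le> d" "e \<le> 2 * c * d" for c d e :: real and i j n
  proof -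
    have "e * \<alpha> ^ n \<le> 2 * c * d * \<alpha> ^ n"
      using that(8) \<alpha>0 by (intro mult_right_mono) auto
    also have "\<dots> \<le> theta n"
      using that \<alpha>0 by (intro doubling_bound) auto
    finally show ?thesis .
  qed
  \<comment> \<open>The constants are lower estimates of theta m / 2.1566 ^ m, chosen so that the
    products 2 * c * d used below reach 0.7072; the tightest is 2 * 0.604 * 0.588 at length
    25.\<close>
  have c12: "0.604 * \<alpha> ^ 12 \<le> theta 12"
    by (rule small[OF _ theta_ge_12_to_19(1)]) (simp_all add: power_divide)
  have c13: "0.588 * \<alpha> ^ 13 \<le> theta 13"
    by (rule small[OF _ theta_ge_12_to_19(2)]) (simp_all add: power_divide)
  have c14: "0.62 * \<alpha> ^ 14 \<le> theta 14"
    by (rule small[OF _ theta_ge_12_to_19(3)]) (simp_all add: power_divide)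
  have c15: "0.7 * \<alpha> ^ 15 \<le> theta 15"
    by (rule small[OF _ theta_ge_12_to_19(4)]) (simp_all add: power_divide)
  have c16: "0.7 * \<alpha> ^ 16 \<le> theta 16"
    by (rule small[OF _ theta_ge_12_to_19(5)]) (simp_all add: power_divide)
  have c17: "0.7 * \<alpha> ^ 17 \<le> theta 17"
    by (rule small[OF _ theta_ge_12_to_19(6)]) (simp_all add: power_divide)
  have c18: "0.6 * \<alpha> ^ 18 \<le> theta 18"
    by (rule small[OF _ theta_ge_12_to_19(7)]) (simp_all add: power_divide)
  have c19: "0.6 * \<alpha> ^ 19 \<le> theta 19"
    by (rule small[OF _ theta_ge_12_to_19(8)]) (simp_all add: power_divide)
  have c20: "0.6 * \<alpha> ^ 20 \<le> theta 20"
    by (rule small[OF _ theta_ge_20_to_26(1)]) (simp_all add: power_divide)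
  \<comment> \<open>Any constant that is at least \<open>sqrt (1/2)\<close> suffices here: doubling then gives the constant 1.\<close>
  define good where "good m \<longleftrightarrow> 0.7072 * \<alpha> ^ m \<le> theta m" for m
  have good: "good m" if "22 \<le> m" "m \<le> 40" for m
  proof -
    have c22: "good 22"
      unfolding good_def by (rule small[OF _ theta_ge_20_to_26(2)]) (simp_all add: power_divide)
    have c23: "good 23"
      unfolding good_def by (rule small[OF _ theta_ge_20_to_26(3)]) (simp_all add: power_divide)
    have c26: "good 26"
      unfolding good_def by (rule small[OF _ theta_ge_20_to_26(4)]) (simp_all add: power_divide)
    have c24: "good 24"
      unfolding good_def by (rule doubled[OF c12 c12]) simp_all
    have c25: "good 25"
      unfolding good_def by (rule doubled[OF c12 c13]) simp_all
    have c27: "good 27"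
      unfolding good_def by (rule doubled[OF c13 c14]) simp_all
    have c28: "good 28"
      unfolding good_def by (rule doubled[OF c14 c14]) simp_all
    have c29: "good 29"
      unfolding good_def by (rule doubled[OF c14 c15]) simp_all
    have c30: "good 30"
      unfolding good_def by (rule doubled[OF c15 c15]) simp_all
    have c31: "good 31"
      unfolding good_def by (rule doubled[OF c15 c16]) simp_all
    have c32: "good 32"
      unfolding good_def by (rule doubled[OF c16 c16]) simp_all
    have c33: "good 33"
      unfolding good_def by (rule doubled[OF c16 c17]) simp_all
    have c34: "good 34"
      unfolding good_def by (rule doubled[OF c17 c17]) simp_all
    have c35: "good 35"
      unfolding good_def by (rule doubled[OF c17 c18]) simp_all
    have c36: "good 36"
      unfolding good_def by (rule doubled[OF c18 c18]) simp_all
    have c37: "good 37"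
      unfolding good_def by (rule doubled[OF c18 c19]) simp_all
    have c38: "good 38"
      unfolding good_def by (rule doubled[OF c19 c19]) simp_all
    have c39: "good 39"
      unfolding good_def by (rule doubled[OF c19 c20]) simp_all
    have c40: "good 40"
      by (simp add: good_def \<alpha>40)
    have "\<forall>m\<in>set [22..<41]. good m"
      by (simp add: c22 c23 c24 c25 c26 c27 c28 c29 c30 c31 c32 c33 c34 c35 c36 c37 c38 c39 c40)
    moreover have "m \<in> set [22..<41]"
      unfolding set_upt using that by simp
    ultimately show ?thesis ..
  qed
  have base: "\<alpha> ^ n \<le> theta n" if n: "40 \<le> n" "n \<le> 80" for n
  proof -
    \<comment> \<open>From 44 on both halves lie between 22 and 40, where \<open>good\<close>
      applies; the four smaller lengths use computed values.\<close>
    consider "n = 40" | "n = 41" | "n = 42" | "n = 43" | "44 \<le> n"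
      using n by linarith
    then show ?thesis
    proof cases
      case 1
      then show ?thesis by (simp add: \<alpha>40)
    next
      case 2
      then show ?thesis
        using small[OF _ theta_ge_41, of 1] by (simp add: power_divide)
    next
      case 3
      then show ?thesis
        using small[OF _ theta_ge_42, of 1] by (simp add: power_divide)
    next
      case 4
      then show ?thesis
        using small[OF _ theta_ge_43, of 1] by (simp add: power_divide)
    next
      case 5
      have "good (n div 2)" "good ((n + 1) div 2)"
        using 5 n by (auto intro!: good)
      then have "1 * \<alpha> ^ n \<le> theta n"
        unfolding good_def by (rule doubled) (use n in simp_all)
      then show ?thesis by simp
    qed
  qed
  \<comment> \<open>Here q stands for p - 2. The upper end is one larger than in the theorem, so
    that \<open>(n + 1) div 2\<close> stays in the range for the induction.\<close>
  have main: "5 * 2 ^ (q + 3) \<le> n \<Longrightarrow> n \<le> 5 * 2 ^ (q + 4) \<Longrightarrow>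
      2 ^ (2 ^ q - 1) * \<alpha> ^ n \<le> theta n" for q n
  proof (induction q arbitrary: n)
    case 0
    then show ?case using base[of n] by simp
  next
    case (Suc q)
    \<comment> \<open>Doubling turns the constant 2 ^ e into 2 ^ (2 * e + 1), and e = 2 ^ q - 1
      satisfies this recursion.\<close>
    have exp: "Suc (2 ^ q - 1 + (2 ^ q - 1)) = 2 ^ Suc q - (1 :: nat)"
      using one_le_power[of "2 :: nat" q] unfolding power_Suc by linarith
    show ?case
    proof (rule doubled)
      show "2 ^ (2 ^ q - 1) * \<alpha> ^ (n div 2) \<le> theta (n div 2)"
        using Suc.prems by (intro Suc.IH) (auto simp: power_add)
      show "2 ^ (2 ^ q - 1) * \<alpha> ^ ((n + 1) div 2) \<le> theta ((n + 1) div 2)"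
        using Suc.prems by (intro Suc.IH) (auto simp: power_add)
      have "80 * 2 ^ q \<le> n"
        using Suc.prems(1) by (simp add: power_add)
      moreover have "1 \<le> (2 :: nat) ^ q"
        by simp
      ultimately show "2 \<le> n"
        by linarith
      show "(2 :: real) ^ (2 ^ Suc q - 1) \<le> 2 * 2 ^ (2 ^ q - 1) * 2 ^ (2 ^ q - 1)"
        unfolding exp[symmetric] by (simp only: power_Suc power_add mult.assoc order_refl)
    qed simp_all
  qed
  show ?thesis
  proof (intro conjI allI impI)
    fix p n :: nat
    assume p: "2 \<le> p" and n: "5 * 2 ^ (p + 1) \<le> n" "n \<le> 5 * 2 ^ (p + 2) - 1"
    obtain q where q: "p = q + 2"
      using p by (metis add.commute le_Suc_ex)
    have "5 * 2 ^ (q + 3) \<le> n" "n \<le> 5 * 2 ^ (q + 4)"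
      using n by (simp_all add: q power_add)
    then show "2 ^ (2 ^ (p - 2) - 1) * \<alpha> ^ n \<le> real (theta n)"
      using main[of q n] by (simp add: q)
  qed (fact theta40)
qed

end
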